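(* Let $a\in\mathbb{R}$, $r\ge1$, and let $c:[0,\infty)\to[0,\infty)$ be a non-increasing coupling function with $c(t)\sim 1/t^r$ as $t\to\infty$. Let $g(t)=A(t)\,\theta^1\otimes\theta^1+B(t)\,\theta^2\otimes\theta^2+C(t)\,\theta^3\otimes\theta^3$, $t\ge0$, be a family of left-invariant metrics on $\mathrm{Nil}^3$, with initial values $A(0)=A_0>0$, $B(0)=B_0>0$, $C(0)=C_0>0$, which together with the map $\phi:\mathrm{Nil}^3\to\mathbb{R}$, $\phi(x,y,z)=ax$, is a solution of harmonic-Ricci flow with coupling function $c(t)$. Put $\Phi=B_0C_0$. Then, as $t\to\infty$, $$A(t)\sim\alpha\,t^{1/3},\qquad B(t)\sim\sqrt{\frac{3\Phi}{\alpha}}\;t^{1/3},\qquad C(t)\sim\sqrt{\frac{\alpha\Phi}{3}}\;t^{-1/3},$$ for some constant $\alpha>0$ depending on $r$ and the initial data.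
   Context: $\mathrm{Nil}^3$ is the Lie group of real upper triangular matrices $\begin{pmatrix}1&x&z\\0&1&y\\0&0&1\end{pmatrix}$, with coordinates $(x,y,z)$, and $\theta^1=dx$, $\theta^2=dy$, $\theta^3=dz-x\,dy$ is the standard left-invariant coframe. The harmonic-Ricci flow for metrics $g(t)$ and maps $\phi(t):(\mathrm{Nil}^3,g(t))\to(\mathbb{R},g_{\mathrm{can}})$ with coupling function $c=c(t)$ is $$\partial_tg=-2\,\mathrm{Rc}[g]+2c\,d\phi\otimes d\phi,\qquad\partial_t\phi=\tau_{g}\phi,$$ where $\tau_g\phi$ is the tension field (here the Laplacian of $\phi$ with respect to $g$). For $g(t)$ diagonal as in the claim and $\phi(x,y,z)=ax$ (which is harmonic, hence constant in time, with $d\phi\otimes d\phi=a^2\theta^1\otimes\theta^1$), the flow is the ODE system $$A'=\frac{C}{B}+2a^2c(t),\qquad B'=\frac{C}{A},\qquad C'=-\frac{C^2}{AB},$$ for which the quantity $BC=\Phi$ is conserved. The notation $u(t)\sim v(t)$ means $\lim_{t\to\infty}u(t)/v(t)=1$. *)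

theory Defs
  imports "HOL-Analysis.Analysis" "HOL-Library.Landau_Symbols"
begin

section \<open>Riemannian geometry in a global chart\<close>

text \<open>
  The manifold is covered by one chart \<open>real ^ 'n\<close>. A covariant 2-tensor field is given by
  its matrix of components with respect to the coordinate frame.
\<close>

definition pd :: "'n \<Rightarrow> (real ^ 'n \<Rightarrow> real) \<Rightarrow> real ^ 'n \<Rightarrow> real" where
  "pd i f p = deriv (\<lambda>s. f (p + s *\<^sub>R axis i 1)) 0"

primrec Ck :: "nat \<Rightarrow> (real ^ 'n \<Rightarrow> real) \<Rightarrow> bool" where
  "Ck 0 f \<longleftrightarrow> continuous_on UNIV f"
| "Ck (Suc k) f \<longleftrightarrow> (\<forall>p. f differentiable (at p)) \<and> (\<forall>i. Ck k (pd i f))"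

definition smooth :: "(real ^ 'n \<Rightarrow> real) \<Rightarrow> bool" where
  "smooth f \<longleftrightarrow> (\<forall>k. Ck k f)"

definition riemannian_metric :: "(real ^ 'n \<Rightarrow> real ^ 'n ^ 'n) \<Rightarrow> bool" where
  "riemannian_metric g \<longleftrightarrow>
     (\<forall>i j. smooth (\<lambda>p. g p $ i $ j)) \<and>
     (\<forall>p. transpose (g p) = g p \<and> (\<forall>v. v \<noteq> 0 \<longrightarrow> v \<bullet> (g p *v v) > 0))"

text \<open>\<open>christoffel g k i j\<close> is the Levi-Civita symbol with upper index \<open>k\<close>.\<close>

definition christoffel ::
    "(real ^ 'n \<Rightarrow> real ^ 'n ^ 'n) \<Rightarrow> 'n \<Rightarrow> 'n \<Rightarrow> 'n \<Rightarrow> real ^ 'n \<Rightarrow> real" where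
  "christoffel g k i j p =
     (\<Sum>l\<in>UNIV. matrix_inv (g p) $ k $ l *
        (pd i (\<lambda>q. g q $ j $ l) p + pd j (\<lambda>q. g q $ i $ l) p - pd l (\<lambda>q. g q $ i $ j) p)) / 2"

text \<open>Sign convention: the Ricci tensor of a round sphere is positive.\<close>

definition ricci :: "(real ^ 'n \<Rightarrow> real ^ 'n ^ 'n) \<Rightarrow> real ^ 'n \<Rightarrow> real ^ 'n ^ 'n" where
  "ricci g p = (\<chi> i j.
     (\<Sum>k\<in>UNIV. pd k (christoffel g k i j) p - pd j (christoffel g k i k) p) +
     (\<Sum>k\<in>UNIV. \<Sum>l\<in>UNIV.
        christoffel g k k l p * christoffel g l i j p -
        christoffel g k j l p * christoffel g l i k p))"

text \<open>
  The tension field of a map into the real line with its canonical metric: the target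
  Christoffel symbol vanishes, which leaves the trace of the Hessian, i.e. the Laplacian.
\<close>

definition tension_field ::
    "(real ^ 'n \<Rightarrow> real ^ 'n ^ 'n) \<Rightarrow> (real ^ 'n \<Rightarrow> real) \<Rightarrow> real ^ 'n \<Rightarrow> real" where
  "tension_field g f p =
     (\<Sum>i\<in>UNIV. \<Sum>j\<in>UNIV. matrix_inv (g p) $ i $ j *
        (pd i (pd j f) p - (\<Sum>k\<in>UNIV. christoffel g k i j p * pd k f p)))"

text \<open>
  Solutions for all times \<open>t \<ge> 0\<close>; the time derivative at \<open>t = 0\<close> is one-sided.
\<close>

definition harmonic_ricci_flow ::
    "(real \<Rightarrow> real) \<Rightarrow> (real \<Rightarrow> real ^ 'n \<Rightarrow> real ^ 'n ^ 'n) \<Rightarrow> (real \<Rightarrow> real ^ 'n \<Rightarrow> real) \<Rightarrow> bool"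
  where
  "harmonic_ricci_flow c g \<phi> \<longleftrightarrow>
     (\<forall>t\<ge>0. riemannian_metric (g t) \<and> smooth (\<phi> t) \<and>
       (\<forall>p i j. ((\<lambda>s. g s p $ i $ j) has_real_derivative
          (- 2 * ricci (g t) p $ i $ j + 2 * c t * (pd i (\<phi> t) p * pd j (\<phi> t) p)))
          (at t within {0..})) \<and>
       (\<forall>p. ((\<lambda>s. \<phi> s p) has_real_derivative tension_field (g t) (\<phi> t) p) (at t within {0..})))"

section \<open>The group \<open>Nil\<^sup>3\<close>\<close>

text \<open>
  A point \<open>p\<close> of \<open>Nil\<^sup>3\<close> is given by its coordinates \<open>p$1 = x\<close>, \<open>p$2 = y\<close>, \<open>p$3 = z\<close>.
  The maps \<open>\<theta>\<^sub>1\<close>, \<open>\<theta>\<^sub>2\<close>, \<open>\<theta>\<^sub>3\<close> below return the components of the one-forms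
  \<open>dx\<close>, \<open>dy\<close>, \<open>dz - x dy\<close> with respect to \<open>dx, dy, dz\<close>.
\<close>

definition nil_matrix :: "real ^ 3 \<Rightarrow> real ^ 3 ^ 3" where
  "nil_matrix p = vector [vector [1, p$1, p$3], vector [0, 1, p$2], vector [0, 0, 1]]"

definition nil_mult :: "real ^ 3 \<Rightarrow> real ^ 3 \<Rightarrow> real ^ 3" where
  "nil_mult p q = vector [p$1 + q$1, p$2 + q$2, p$3 + q$3 + p$1 * q$2]"

lemma nil_matrix_mult: "nil_matrix (nil_mult p q) = nil_matrix p ** nil_matrix q"
  by (simp add: vec_eq_iff forall_3 nil_matrix_def nil_mult_def matrix_matrix_mult_def sum_3
      algebra_simps)

definition \<theta>\<^sub>1 :: "real ^ 3 \<Rightarrow> real ^ 3" where "\<theta>\<^sub>1 p = vector [1, 0, 0]"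
definition \<theta>\<^sub>2 :: "real ^ 3 \<Rightarrow> real ^ 3" where "\<theta>\<^sub>2 p = vector [0, 1, 0]"
definition \<theta>\<^sub>3 :: "real ^ 3 \<Rightarrow> real ^ 3" where "\<theta>\<^sub>3 p = vector [0, - (p$1), 1]"

lemma nil_mult_has_derivative:
  "(nil_mult p has_derivative (\<lambda>v. vector [v$1, v$2, v$3 + p$1 * v$2])) (at q)"
proof -
  have "linear (\<lambda>v::real^3. vector [v$1, v$2, v$3 + p$1 * v$2] :: real^3)"
    by (rule linearI) (simp_all add: vec_eq_iff forall_3 algebra_simps)
  then have "bounded_linear (\<lambda>v::real^3. vector [v$1, v$2, v$3 + p$1 * v$2] :: real^3)"
    by (simp add: linear_conv_bounded_linear)
  then have "((\<lambda>q. p + vector [q$1, q$2, q$3 + p$1 * q$2]) has_derivative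
      (\<lambda>v. 0 + vector [v$1, v$2, v$3 + p$1 * v$2])) (at q)"
    by (intro has_derivative_add has_derivative_const bounded_linear_imp_has_derivative)
  moreover have "nil_mult p = (\<lambda>q. p + vector [q$1, q$2, q$3 + p$1 * q$2])"
    by (rule ext) (simp add: vec_eq_iff forall_3 nil_mult_def)
  ultimately show ?thesis
    by simp
qed

lemma nil_coframe_left_invariant:
  assumes "\<theta> \<in> {\<theta>\<^sub>1, \<theta>\<^sub>2, \<theta>\<^sub>3}"
  shows "\<theta> (nil_mult p q) \<bullet> frechet_derivative (nil_mult p) (at q) v = \<theta> q \<bullet> v"
proof -
  have "frechet_derivative (nil_mult p) (at q) = (\<lambda>v. vector [v$1, v$2, v$3 + p$1 * v$2])"
    using frechet_derivative_at[OF nil_mult_has_derivative] by metis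
  then show ?thesis
    using assms
    by (auto simp: \<theta>\<^sub>1_def \<theta>\<^sub>2_def \<theta>\<^sub>3_def nil_mult_def inner_vec_def sum_3 algebra_simps)
qed

definition tensor :: "real ^ 'n \<Rightarrow> real ^ 'n \<Rightarrow> real ^ 'n ^ 'n" (infixr "\<otimes>\<^sub>t" 75) where
  "u \<otimes>\<^sub>t v = (\<chi> i j. u $ i * v $ j)"

definition nil_metric :: "real \<Rightarrow> real \<Rightarrow> real \<Rightarrow> real ^ 3 \<Rightarrow> real ^ 3 ^ 3" where
  "nil_metric A B C p =
     A *\<^sub>R (\<theta>\<^sub>1 p \<otimes>\<^sub>t \<theta>\<^sub>1 p) + B *\<^sub>R (\<theta>\<^sub>2 p \<otimes>\<^sub>t \<theta>\<^sub>2 p) + C *\<^sub>R (\<theta>\<^sub>3 p \<otimes>\<^sub>t \<theta>\<^sub>3 p)"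

end

theory Submission
  imports Defs "HOL-Real_Asymp.Real_Asymp"
begin

text \<open>
  Evaluating the Ricci tensor at the origin turns the flow into the ODE system for \<open>A\<close>, \<open>B\<close>, \<open>C\<close>,
  and conservation of \<open>B C = \<Phi>\<close> leaves \<open>A' = \<Phi> / B\<^sup>2 + f\<close>, \<open>B' = \<Phi> / (A B)\<close> with \<open>f = 2 a\<^sup>2 c\<close>.
  Put \<open>E = A\<^sup>2 / B\<^sup>2\<close> and \<open>P = A B\<^sup>2\<close>, so that \<open>A\<^sup>3 = E P\<close>, \<open>(ln E)' = 2 f / A\<close> and
  \<open>P' = 3 \<Phi> + f B\<^sup>2\<close>. As \<open>E\<close> increases and \<open>P \<ge> 3 \<Phi> t\<close>, \<open>A\<close> grows at least like \<open>t\<close> to the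
  power \<open>1/3\<close>; since \<open>f = O(1/t)\<close>, the function \<open>2 f / A\<close> is integrable and \<open>E\<close> has a limit \<open>L\<close>.
  Moreover \<open>(B\<^sup>2)' = 2 \<Phi> / A\<close> tends to \<open>0\<close>, so \<open>f B\<^sup>2\<close> tends to \<open>0\<close>, and \<open>P / t\<close> tends to \<open>3 \<Phi>\<close> by
  l'Hopital's rule. Hence \<open>\<alpha>\<close> is the cube root of \<open>3 \<Phi> L\<close>. That \<open>\<alpha>\<close> depends only on the data
  is uniqueness for the ODE, a Gronwall estimate in which the possibly discontinuous \<open>f\<close> cancels.
\<close>

section \<open>Curvature of diagonal left-invariant metrics\<close>

text \<open>The metric components and Christoffel symbols below depend on x alone, so their partial
  derivatives reduce to one-variable calculus.\<close>

lemma pd_fst_coordinate: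
  fixes F :: "real \<Rightarrow> real" and p :: "real ^ 3"
  assumes "(F has_real_derivative D) (at (p $ 1))"
  shows "pd i (\<lambda>q. F (q $ 1)) p = (if i = 1 then D else 0)"
proof (cases "i = 1")
  case True
  have "((\<lambda>s. F (p $ 1 + s)) has_real_derivative D) (at 0)"
    using assms by (simp add: DERIV_shift [symmetric] add.commute)
  then show ?thesis
    using True by (simp add: pd_def axis_def DERIV_imp_deriv)
next
  case False
  then show ?thesis
    by (simp add: pd_def axis_def)
qed

lemma matrix_inv_unique:
  fixes A :: "'a::semiring_1 ^ 'n ^ 'n"
  assumes "A ** B = mat 1" "B ** A = mat 1"
  shows "matrix_inv A = B"
proof -
  have "A ** matrix_inv A = mat 1 \<and> matrix_inv A ** A = mat 1"
    unfolding matrix_inv_def by (rule someI [of _ B]) (use assms in simp)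
  then show ?thesis
    by (metis assms(2) matrix_mul_assoc matrix_mul_lid matrix_mul_rid)
qed

lemma nil_metric_eq:
  "nil_metric A B C p = vector [vector [A, 0, 0],
     vector [0, B + C * (p $ 1)\<^sup>2, - C * p $ 1], vector [0, - C * p $ 1, C]]"
  by (simp add: vec_eq_iff forall_3 nil_metric_def tensor_def \<theta>\<^sub>1_def \<theta>\<^sub>2_def \<theta>\<^sub>3_def power2_eq_square)

lemma matrix_inv_nil_metric:
  assumes "A \<noteq> 0" "B \<noteq> 0" "C \<noteq> 0"
  shows "matrix_inv (nil_metric A B C p) = vector [vector [1 / A, 0, 0],
     vector [0, 1 / B, p $ 1 / B], vector [0, p $ 1 / B, 1 / C + (p $ 1)\<^sup>2 / B]]"
  by (rule matrix_inv_unique)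
    (use assms in \<open>simp_all add: vec_eq_iff forall_3 nil_metric_eq matrix_matrix_mult_def sum_3
       mat_def field_simps power2_eq_square\<close>)

text \<open>The Christoffel symbols in closed form, as functions of x: one matrix, symmetric in
  \<open>i\<close> and \<open>j\<close>, for each upper index \<open>k\<close>.\<close>

definition nil_christoffel :: "real \<Rightarrow> real \<Rightarrow> real \<Rightarrow> 3 \<Rightarrow> 3 \<Rightarrow> 3 \<Rightarrow> real \<Rightarrow> real" where
  "nil_christoffel A B C k i j x = (vector
     [vector [vector [0, 0, 0],
              vector [0, - (C * x / A), C / (2 * A)],
              vector [0, C / (2 * A), 0]],
      vector [vector [0, C * x / (2 * B), - (C / (2 * B))],
              vector [C * x / (2 * B), 0, 0],
              vector [- (C / (2 * B)), 0, 0]],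
      vector [vector [0, (C * x\<^sup>2 / B - 1) / 2, - (C * x / (2 * B))],
              vector [(C * x\<^sup>2 / B - 1) / 2, 0, 0],
              vector [- (C * x / (2 * B)), 0, 0]]] :: real ^ 3 ^ 3 ^ 3) $ k $ i $ j"

lemma pd_nil_metric:
  "pd i (\<lambda>q. nil_metric A B C q $ j $ k) p = (if i = 1 then (vector [0,
     vector [0, 2 * C * p $ 1, - C], vector [0, - C, 0]] :: real ^ 3 ^ 3) $ j $ k else 0)"
proof -
  have "((\<lambda>x. (vector [vector [A, 0, 0], vector [0, B + C * x\<^sup>2, - C * x],
      vector [0, - C * x, C]] :: real ^ 3 ^ 3) $ j $ k) has_real_derivative
     (vector [0, vector [0, 2 * C * p $ 1, - C], vector [0, - C, 0]] :: real ^ 3 ^ 3) $ j $ k)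
     (at (p $ 1))"
    using exhaust_3 [of j] exhaust_3 [of k]
    by (elim disjE) (auto intro!: derivative_eq_intros)
  from pd_fst_coordinate [OF this] show ?thesis
    by (simp add: nil_metric_eq)
qed

lemma christoffel_nil_metric:
  assumes "A \<noteq> 0" "B \<noteq> 0" "C \<noteq> 0"
  shows "christoffel (nil_metric A B C) k i j p = nil_christoffel A B C k i j (p $ 1)"
  using exhaust_3 [of k] exhaust_3 [of i] exhaust_3 [of j] assms
  by (elim disjE)
    (simp_all add: christoffel_def matrix_inv_nil_metric pd_nil_metric nil_christoffel_def sum_3
       field_simps power2_eq_square)

lemma pd_christoffel_nil_metric_origin:
  assumes "A \<noteq> 0" "B \<noteq> 0" "C \<noteq> 0"
  shows "pd l (christoffel (nil_metric A B C) k i j) 0 = (if l = 1 then (vector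
     [vector [0, vector [0, - (C / A), 0], 0],
      vector [vector [0, C / (2 * B), 0], vector [C / (2 * B), 0, 0], 0],
      vector [vector [0, 0, - (C / (2 * B))], 0, vector [- (C / (2 * B)), 0, 0]]]
      :: real ^ 3 ^ 3 ^ 3) $ k $ i $ j else 0)" (is "_ = (if _ then ?D else 0)")
proof -
  have "(nil_christoffel A B C k i j has_real_derivative ?D) (at ((0 :: real ^ 3) $ 1))"
    unfolding nil_christoffel_def
    using exhaust_3 [of k] exhaust_3 [of i] exhaust_3 [of j] assms
    by (elim disjE) (auto intro!: derivative_eq_intros)
  moreover have "christoffel (nil_metric A B C) k i j = (\<lambda>q. nil_christoffel A B C k i j (q $ 1))"
    by (rule ext) (rule christoffel_nil_metric [OF assms])
  ultimately show ?thesis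
    using pd_fst_coordinate by simp
qed

lemma ricci_nil_metric_origin:
  assumes "A \<noteq> 0" "B \<noteq> 0" "C \<noteq> 0"
  shows "ricci (nil_metric A B C) 0 $ 1 $ 1 = - C / (2 * B)"
    and "ricci (nil_metric A B C) 0 $ 2 $ 2 = - C / (2 * A)"
    and "ricci (nil_metric A B C) 0 $ 3 $ 3 = C\<^sup>2 / (2 * A * B)"
  using assms
  by (simp_all add: ricci_def sum_3 pd_christoffel_nil_metric_origin christoffel_nil_metric
     nil_christoffel_def field_simps power2_eq_square)

text \<open>At the origin the coframe is dx, dy, dz, so the diagonal entries of the metric there are
  \<open>A\<close>, \<open>B\<close>, \<open>C\<close> themselves, and the flow equation at this one
  point gives their derivatives. Positivity comes from testing the metric on coordinate
  vectors.\<close>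

lemma nil_flow_ode:
  assumes flow: "harmonic_ricci_flow c (\<lambda>t. nil_metric (A t) (B t) (C t)) (\<lambda>t p. a * p $ 1)"
    and t: "t \<ge> 0"
  shows "A t > 0" "B t > 0" "C t > 0"
    and "(A has_real_derivative C t / B t + 2 * a\<^sup>2 * c t) (at t within {0..})"
    and "(B has_real_derivative C t / A t) (at t within {0..})"
    and "(C has_real_derivative - (C t)\<^sup>2 / (A t * B t)) (at t within {0..})"
proof -
  have pos: "axis i 1 \<bullet> (nil_metric (A t) (B t) (C t) 0 *v axis i 1) > 0" for i
  proof -
    have "axis i (1 :: real) \<noteq> 0"
      by (simp add: axis_eq_0_iff)
    then show ?thesis
      using flow t by (auto simp: harmonic_ricci_flow_def riemannian_metric_def)
  qed
  show p: "A t > 0" "B t > 0" "C t > 0"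
    using pos [of 1] pos [of 2] pos [of 3]
    by (simp_all add: nil_metric_eq inner_vec_def matrix_vector_mult_def sum_3 axis_def)
  have phi: "pd i (\<lambda>p. a * p $ 1) 0 = (if i = 1 then a else 0)" for i :: 3
    by (rule pd_fst_coordinate) (auto intro!: derivative_eq_intros)
  have d: "((\<lambda>s. nil_metric (A s) (B s) (C s) 0 $ i $ j) has_real_derivative
      (- 2 * ricci (nil_metric (A t) (B t) (C t)) 0 $ i $ j +
        2 * c t * (pd i (\<lambda>p. a * p $ 1) 0 * pd j (\<lambda>p. a * p $ 1) 0))) (at t within {0..})" for i j
    using flow t unfolding harmonic_ricci_flow_def by blast
  show "(A has_real_derivative C t / B t + 2 * a\<^sup>2 * c t) (at t within {0..})"
    "(B has_real_derivative C t / A t) (at t within {0..})"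
    "(C has_real_derivative - (C t)\<^sup>2 / (A t * B t)) (at t within {0..})"
    using d [of 1 1] d [of 2 2] d [of 3 3] p
    by (simp_all add: ricci_nil_metric_origin phi nil_metric_eq power2_eq_square mult_ac)
qed

section \<open>The reduced ODE system\<close>

lemma increasing_if_deriv_within_nonneg:
  fixes F F' :: "real \<Rightarrow> real"
  assumes deriv: "\<And>t. t \<ge> b \<Longrightarrow> (F has_real_derivative F' t) (at t within {b..})"
    and nonneg: "\<And>t. t \<ge> b \<Longrightarrow> F' t \<ge> 0"
    and "b \<le> s" "s \<le> t"
  shows "F s \<le> F t"
proof (rule DERIV_nonneg_imp_increasing_open [OF \<open>s \<le> t\<close>])
  fix x assume "s < x" "x < t"
  \<comment> \<open>In the interior the derivative within the half-line is two-sided; at the end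
    point continuity suffices.\<close>
  then have "x \<ge> b" "at x within {b..} = at x"
    using assms by (auto intro!: at_within_interior)
  then show "\<exists>y. (F has_real_derivative y) (at x) \<and> 0 \<le> y"
    using deriv [of x] nonneg [of x] by auto
next
  have "continuous_on {b..} F"
    by (rule DERIV_continuous_on) (use deriv in auto)
  then show "continuous_on {s..t} F"
    by (rule continuous_on_subset) (use assms in auto)
qed

lemma eventually_deriv_at_top:
  fixes F F' :: "real \<Rightarrow> real"
  assumes "\<And>t. t \<ge> b \<Longrightarrow> (F has_real_derivative F' t) (at t within {b..})"
  shows "\<forall>\<^sub>F t in at_top. (F has_real_derivative F' t) (at t)"
  using eventually_gt_at_top [of b]
proof eventually_elim
  case (elim t)
  then have "at t within {b..} = at t"
    by (intro at_within_interior) simp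
  then show ?case
    using assms [of t] elim by simp
qed

text \<open>The limit is the supremum. Its lower bound \<open>F b\<close> later keeps the limit of
  \<open>E\<close> positive.\<close>

lemma increasing_bounded_tendsto:
  fixes F :: "real \<Rightarrow> real"
  assumes mono: "\<And>s t. b \<le> s \<Longrightarrow> s \<le> t \<Longrightarrow> F s \<le> F t"
    and bound: "\<And>t. t \<ge> b \<Longrightarrow> F t \<le> M"
  shows "\<exists>L \<ge> F b. (F \<longlongrightarrow> L) at_top"
proof -
  define L where "L = (SUP t\<in>{b..}. F t)"
  have bdd: "bdd_above (F ` {b..})"
    using bound by (auto intro!: bdd_aboveI)
  have le: "F t \<le> L" if "t \<ge> b" for t
    unfolding L_def using bdd that by (auto intro: cSUP_upper)
  have "(F \<longlongrightarrow> L) at_top"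
  proof (rule increasing_tendsto)
    show "\<forall>\<^sub>F t in at_top. F t \<le> L"
      using eventually_ge_at_top [of b] by eventually_elim (rule le)
    fix x assume "x < L"
    then obtain s where s: "s \<ge> b" "x < F s"
      unfolding L_def using bdd by (subst (asm) less_cSUP_iff) auto
    show "\<forall>\<^sub>F t in at_top. x < F t"
      using eventually_ge_at_top [of s]
    proof eventually_elim
      case (elim t)
      then show ?case
        using s mono [of s t] by linarith
    qed
  qed
  then show ?thesis
    using le [of b] by auto
qed

lemma powr_third_cube:
  fixes x :: real
  assumes "x > 0"
  shows "(x ^ 3) powr (1/3) = x"
proof -
  have "(x powr 3) powr (1/3) = x"
    using assms by (subst powr_powr) simp
  then show ?thesis
    using assms by simp
qed

text \<open>The system left after eliminating \<open>C = \<Phi> / B\<close>. The forcing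
  \<open>f\<close> stands for \<open>2 a^2 c\<close>; only its sign is fixed here, and its decay is
  assumed where limits are taken.\<close>

locale reduced_nil_flow =
  fixes A B f :: "real \<Rightarrow> real" and \<Phi> :: real
  assumes \<Phi>_pos: "\<Phi> > 0"
    and A_pos: "t \<ge> 0 \<Longrightarrow> A t > 0"
    and B_pos: "t \<ge> 0 \<Longrightarrow> B t > 0"
    and A_deriv: "t \<ge> 0 \<Longrightarrow> (A has_real_derivative \<Phi> / (B t)\<^sup>2 + f t) (at t within {0..})"
    and B_deriv: "t \<ge> 0 \<Longrightarrow> (B has_real_derivative \<Phi> / (A t * B t)) (at t within {0..})"
    and f_nonneg: "t \<ge> 0 \<Longrightarrow> f t \<ge> 0"
begin

section \<open>Monotone quantities and lower growth bounds\<close>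

lemma A_mono: "0 \<le> s \<Longrightarrow> s \<le> t \<Longrightarrow> A s \<le> A t"
  by (rule increasing_if_deriv_within_nonneg [OF A_deriv])
    (use \<Phi>_pos f_nonneg in simp_all)

lemma B_mono: "0 \<le> s \<Longrightarrow> s \<le> t \<Longrightarrow> B s \<le> B t"
  by (rule increasing_if_deriv_within_nonneg [OF B_deriv])
    (use \<Phi>_pos in \<open>simp_all add: A_pos B_pos less_imp_le\<close>)

text \<open>The curvature parts of \<open>A' / A\<close> and \<open>B' / B\<close> are both
  \<open>\<Phi> / (A B^2)\<close>: they cancel in the logarithm of \<open>E\<close>, while in
  \<open>P'\<close> the two factors contribute \<open>\<Phi>\<close> and
  \<open>2 \<Phi>\<close>.\<close>

definition E :: "real \<Rightarrow> real" where "E t = (A t)\<^sup>2 / (B t)\<^sup>2"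
definition P :: "real \<Rightarrow> real" where "P t = A t * (B t)\<^sup>2"

lemma E_pos: "t \<ge> 0 \<Longrightarrow> E t > 0"
  using A_pos [of t] B_pos [of t] by (simp add: E_def)

lemma E_mult_P: "t \<ge> 0 \<Longrightarrow> E t * P t = A t ^ 3"
  using B_pos [of t] by (simp add: E_def P_def power2_eq_square power3_eq_cube)

lemma ln_E_deriv:
  assumes "t \<ge> 0"
  shows "((\<lambda>t. ln (E t)) has_real_derivative 2 * f t / A t) (at t within {0..})"
proof -
  have "((\<lambda>t. 2 * ln (A t) - 2 * ln (B t)) has_real_derivative 2 * f t / A t) (at t within {0..})"
    using A_pos [OF assms] B_pos [OF assms]
    by (auto intro!: derivative_eq_intros A_deriv B_deriv assms simp: field_simps power2_eq_square)
  moreover have "2 * ln (A s) - 2 * ln (B s) = ln (E s)" if "s \<ge> 0" for s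
    using A_pos [OF that] B_pos [OF that] by (simp add: E_def ln_div ln_realpow)
  ultimately show ?thesis
    using has_field_derivative_transform_within [OF _ zero_less_one, of _ _ t "{0..}"] assms by auto
qed

lemma P_deriv:
  assumes "t \<ge> 0"
  shows "(P has_real_derivative 3 * \<Phi> + f t * (B t)\<^sup>2) (at t within {0..})"
  unfolding P_def [abs_def] using A_pos [OF assms] B_pos [OF assms]
  by (auto intro!: derivative_eq_intros A_deriv B_deriv assms simp: field_simps power2_eq_square)

lemma E_mono:
  assumes "0 \<le> s" "s \<le> t"
  shows "E s \<le> E t"
proof -
  have "ln (E s) \<le> ln (E t)"
    by (rule increasing_if_deriv_within_nonneg [OF ln_E_deriv])
      (use assms in \<open>simp_all add: A_pos f_nonneg less_imp_le\<close>)
  then show ?thesis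
    using assms E_pos by simp
qed

text \<open>The remaining term \<open>f B^2\<close> of \<open>P'\<close> is non-negative, and the
  positive value \<open>P 0\<close> is dropped.\<close>

lemma P_lower: 
  assumes "t \<ge> 0"
  shows "P t \<ge> 3 * \<Phi> * t"
proof -
  have "P 0 - 3 * \<Phi> * 0 \<le> P t - 3 * \<Phi> * t"
  proof (rule increasing_if_deriv_within_nonneg [where b = 0 and F = "\<lambda>t. P t - 3 * \<Phi> * t"
          and F' = "\<lambda>t. f t * (B t)\<^sup>2"])
    fix t :: real assume t: "t \<ge> 0"
    show "((\<lambda>t. P t - 3 * \<Phi> * t) has_real_derivative f t * (B t)\<^sup>2) (at t within {0..})"
      by (rule derivative_eq_intros P_deriv t refl)+ simp
    show "0 \<le> f t * (B t)\<^sup>2"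
      using f_nonneg t by simp
  qed (use assms in simp_all)
  moreover have "P 0 > 0"
    using A_pos [of 0] B_pos [of 0] by (simp add: P_def)
  ultimately show ?thesis
    by simp
qed

lemma A_lower:
  assumes "t \<ge> 0"
  shows "A t \<ge> (3 * \<Phi> * E 0 * t) powr (1/3)"
proof -
  have "3 * \<Phi> * E 0 * t = E 0 * (3 * \<Phi> * t)"
    by simp
  also have "\<dots> \<le> E t * P t"
    by (intro mult_mono E_mono P_lower) (use assms E_pos [of t] \<Phi>_pos in auto)
  also have "\<dots> = A t ^ 3"
    using assms by (rule E_mult_P)
  finally have "(3 * \<Phi> * E 0 * t) powr (1/3) \<le> (A t ^ 3) powr (1/3)"
    using E_pos [of 0] \<Phi>_pos assms by (intro powr_mono2) auto
  also have "\<dots> = A t"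
    using A_pos [OF assms] by (rule powr_third_cube)
  finally show ?thesis .
qed

section \<open>Limits at infinity\<close>

lemma A_at_top: "filterlim A at_top at_top"
proof (rule filterlim_at_top_mono)
  have "filterlim (\<lambda>t. (k * t) powr (1/3)) at_top at_top" if "k > 0" for k :: real
    using that by real_asymp
  then show "filterlim (\<lambda>t. (3 * \<Phi> * E 0 * t) powr (1/3)) at_top at_top"
    using \<Phi>_pos E_pos [of 0] by simp
  show "\<forall>\<^sub>F t in at_top. (3 * \<Phi> * E 0 * t) powr (1/3) \<le> A t"
    using eventually_ge_at_top [of 0] by eventually_elim (rule A_lower)
qed

lemma E_convergent:
  assumes f_bound: "\<forall>\<^sub>F t in at_top. f t \<le> M / t"
  shows "\<exists>L > 0. (E \<longlongrightarrow> L) at_top"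
proof -
  obtain T where T: "T \<ge> 1" "\<And>t. t \<ge> T \<Longrightarrow> f t \<le> M / t"
    using eventually_conj [OF eventually_ge_at_top [of 1] f_bound]
    unfolding eventually_at_top_linorder by (metis order_refl)
  define k where "k = 3 * \<Phi> * E 0"
  have k: "k > 0"
    using \<Phi>_pos E_pos [of 0] by (simp add: k_def)
  \<comment> \<open>The bound on the non-negative \<open>f\<close> forces the sign of
    \<open>M\<close>; with it the boundary term at \<open>t\<close> below can be discarded.\<close>
  have "0 \<le> M / T"
    using T f_nonneg [of T] by (meson dual_order.trans order_refl zero_le_one)
  then have M_nonneg: "M \<ge> 0"
    using T(1) by (simp add: zero_le_divide_iff)
  \<comment> \<open>Chosen so that dividing \<open>2 M / t\<close> by the lower bound
    \<open>(k t) powr (1/3)\<close> of \<open>A\<close> gives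
    \<open>N t powr (-4/3)\<close>.\<close>
  define N where "N = 2 * M / k powr (1/3)"
  have le: "2 * f t / A t \<le> N * t powr (-4/3)" if "t \<ge> T" for t
  proof -
    have t: "t > 0"
      using T that by simp
    have "2 * f t / A t \<le> (2 * (M / t)) / (k * t) powr (1/3)"
      using T(2) [OF that] t k A_lower [of t] f_nonneg [of t]
      by (intro frac_le) (auto simp: k_def)
    also have "\<dots> = N * (1 / (t powr 1 * t powr (1/3)))"
      using t k by (simp add: N_def powr_mult)
    also have "t powr 1 * t powr (1/3) = t powr (4/3)"
      by (subst powr_add [symmetric]) simp
    also have "1 / t powr (4/3) = t powr (-4/3)"
      by (simp add: powr_minus_divide)
    finally show ?thesis .
  qed
  have "ln (E t) \<le> ln (E T) + 3 * N * T powr (-1/3)" if "t \<ge> T" for t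
  proof -
    \<comment> \<open>The integrated form of the previous estimate, obtained by comparison with the
      antiderivative \<open>-3 N t powr (-1/3)\<close>, so that \<open>f\<close> itself is never
      integrated.\<close>
    have "- ln (E T) - 3 * N * T powr (-1/3) \<le> - ln (E t) - 3 * N * t powr (-1/3)"
    proof (rule increasing_if_deriv_within_nonneg [where b = T
          and F = "\<lambda>t. - ln (E t) - 3 * N * t powr (-1/3)"
          and F' = "\<lambda>t. N * t powr (-4/3) - 2 * f t / A t"])
      fix t assume t: "t \<ge> T"
      have ln: "((\<lambda>t. ln (E t)) has_real_derivative 2 * f t / A t) (at t within {T..})"
        by (rule DERIV_subset [OF ln_E_deriv]) (use t T in auto)
      have powr: "((\<lambda>t. 3 * N * t powr (-1/3)) has_real_derivative - (N * t powr (-4/3)))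
          (at t within {T..})"
        using t T(1) by (auto intro!: derivative_eq_intros)
      show "((\<lambda>t. - ln (E t) - 3 * N * t powr (-1/3)) has_real_derivative
          N * t powr (-4/3) - 2 * f t / A t) (at t within {T..})"
        using DERIV_diff [OF DERIV_minus [OF ln] powr] by simp
    qed (use le that in auto)
    moreover have "N * t powr (-1/3) \<ge> 0"
      using M_nonneg k by (simp add: N_def)
    ultimately show ?thesis
      by simp
  qed
  then have bound: "E t \<le> exp (ln (E T) + 3 * N * T powr (-1/3))" if "t \<ge> T" for t
    using E_pos [of t] T(1) that by (metis exp_le_cancel_iff exp_ln order_trans zero_le_one)
  have "\<exists>L \<ge> E T. (E \<longlongrightarrow> L) at_top"
    by (rule increasing_bounded_tendsto [OF _ bound], rule E_mono) (use T(1) in simp_all)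
  then obtain L where "L \<ge> E T" "(E \<longlongrightarrow> L) at_top"
    by blast
  then show ?thesis
    using E_pos [of T] T(1) by (intro exI [of _ L]) auto
qed

lemma B_sublinear: "((\<lambda>t. (B t)\<^sup>2 / t) \<longlongrightarrow> 0) at_top"
\<comment> \<open>This form of l'Hopital's rule asks only the denominator to tend to infinity, so
  the growth of \<open>B\<close> need not be known beforehand.\<close>
proof (rule lhospital_at_top_at_top [where f' = "\<lambda>t. 2 * \<Phi> / A t" and g' = "\<lambda>_. 1"])
  show "\<forall>\<^sub>F t in at_top. ((\<lambda>t. (B t)\<^sup>2) has_real_derivative 2 * \<Phi> / A t) (at t)"
  proof (rule eventually_deriv_at_top)
    fix t :: real assume t: "t \<ge> 0"
    show "((\<lambda>t. (B t)\<^sup>2) has_real_derivative 2 * \<Phi> / A t) (at t within {0..})"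
      using A_pos [OF t] B_pos [OF t]
      by (auto intro!: derivative_eq_intros B_deriv t simp: field_simps power2_eq_square)
  qed
  show "((\<lambda>t. 2 * \<Phi> / A t / 1) \<longlongrightarrow> 0) at_top"
    by (simp, rule tendsto_divide_0 [OF tendsto_const]) (rule filterlim_at_top_imp_at_infinity [OF A_at_top])
qed (auto intro!: derivative_eq_intros filterlim_ident)

lemma P_asymp:
  assumes f_bound: "\<forall>\<^sub>F t in at_top. f t \<le> M / t"
  shows "((\<lambda>t. P t / t) \<longlongrightarrow> 3 * \<Phi>) at_top"
proof (rule lhospital_at_top_at_top [where f' = "\<lambda>t. 3 * \<Phi> + f t * (B t)\<^sup>2" and g' = "\<lambda>_. 1"])
  have "((\<lambda>t. f t * (B t)\<^sup>2) \<longlongrightarrow> 0) at_top"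
  proof (rule tendsto_sandwich)
    show "\<forall>\<^sub>F t in at_top. 0 \<le> f t * (B t)\<^sup>2"
      using eventually_ge_at_top [of 0] by eventually_elim (simp add: f_nonneg)
    \<comment> \<open>Here the decay \<open>f = O(1/t)\<close> meets the sublinear growth of
      \<open>B^2\<close>.\<close>
    show "\<forall>\<^sub>F t in at_top. f t * (B t)\<^sup>2 \<le> M * ((B t)\<^sup>2 / t)"
      using f_bound
    proof eventually_elim
      case (elim t)
      show ?case using mult_right_mono [OF elim, of "(B t)\<^sup>2"] by simp
    qed
    show "((\<lambda>t. M * ((B t)\<^sup>2 / t)) \<longlongrightarrow> 0) at_top"
      using tendsto_mult_right_zero [OF B_sublinear] .
  qed simp
  from tendsto_add [OF tendsto_const this, of "3 * \<Phi>"]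
  show "((\<lambda>t. (3 * \<Phi> + f t * (B t)\<^sup>2) / 1) \<longlongrightarrow> 3 * \<Phi>) at_top"
    by simp
  show "\<forall>\<^sub>F t in at_top. (P has_real_derivative 3 * \<Phi> + f t * (B t)\<^sup>2) (at t)"
    by (rule eventually_deriv_at_top [OF P_deriv])
qed (auto intro!: derivative_eq_intros filterlim_ident)

lemma asymptotics:
  assumes f_bound: "\<forall>\<^sub>F t in at_top. f t \<le> M / t"
  shows "\<exists>\<alpha> > 0. ((\<lambda>t. A t / t powr (1/3)) \<longlongrightarrow> \<alpha>) at_top \<and>
    ((\<lambda>t. B t / t powr (1/3)) \<longlongrightarrow> sqrt (3 * \<Phi> / \<alpha>)) at_top"
proof -
  obtain L where L: "L > 0" "(E \<longlongrightarrow> L) at_top"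
    using E_convergent [OF f_bound] by auto
  define \<alpha> where "\<alpha> = (L * (3 * \<Phi>)) powr (1/3)"
  have \<alpha>: "\<alpha> > 0"
    using L \<Phi>_pos by (simp add: \<alpha>_def)
  have "((\<lambda>t. (E t * (P t / t)) powr (1/3)) \<longlongrightarrow> \<alpha>) at_top"
    unfolding \<alpha>_def using L \<Phi>_pos by (intro tendsto_intros P_asymp [OF f_bound]) auto
  moreover have "\<forall>\<^sub>F t in at_top. (E t * (P t / t)) powr (1/3) = A t / t powr (1/3)"
    using eventually_gt_at_top [of 0]
  proof eventually_elim
    case (elim t)
    then have "E t * (P t / t) = A t ^ 3 / t"
      using E_mult_P [of t] by simp
    then show ?case
      using elim A_pos [of t] by (simp add: powr_divide powr_third_cube)
  qed
  ultimately have A: "((\<lambda>t. A t / t powr (1/3)) \<longlongrightarrow> \<alpha>) at_top"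
    by (rule Lim_transform_eventually)
  \<comment> \<open>\<open>B\<close> is recovered from \<open>B^2 = P / A\<close>, whose limit after
    scaling by \<open>t powr (2/3)\<close> is \<open>3 \<Phi> / \<alpha>\<close>.\<close>
  have "((\<lambda>t. sqrt ((P t / t) / (A t / t powr (1/3)))) \<longlongrightarrow> sqrt (3 * \<Phi> / \<alpha>)) at_top"
    using \<alpha> by (intro tendsto_intros P_asymp [OF f_bound] A) auto
  moreover have "\<forall>\<^sub>F t in at_top. sqrt ((P t / t) / (A t / t powr (1/3))) = B t / t powr (1/3)"
    using eventually_gt_at_top [of 0]
  proof eventually_elim
    case (elim t)
    have "t = (t powr (1/3)) ^ 3"
      using elim by (simp add: powr_power)
    then have "t powr (1/3) / t = 1 / (t powr (1/3))\<^sup>2"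
      using elim by (simp add: field_simps power2_eq_square power3_eq_cube)
    then have "(P t / t) / (A t / t powr (1/3)) = (B t / t powr (1/3))\<^sup>2"
      using A_pos [of t] elim by (simp add: P_def power_divide field_simps)
    then show ?case
      using B_pos [of t] elim by simp
  qed
  ultimately have "((\<lambda>t. B t / t powr (1/3)) \<longlongrightarrow> sqrt (3 * \<Phi> / \<alpha>)) at_top"
    by (rule Lim_transform_eventually)
  with A \<alpha> show ?thesis by blast
qed

end

section \<open>Uniqueness for the reduced system\<close>

lemma reduced_nil_flow_unique:
  assumes "reduced_nil_flow A1 B1 f \<Phi>" "reduced_nil_flow A2 B2 f \<Phi>"
    and init: "A1 0 = A2 0" "B1 0 = B2 0"
    and "t \<ge> 0"
  shows "A1 t = A2 t"
proof -
  interpret S1: reduced_nil_flow A1 B1 f \<Phi> by fact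
  interpret S2: reduced_nil_flow A2 B2 f \<Phi> by fact
  define x where "x t = A1 t - A2 t" for t
  \<comment> \<open>Squares are compared because \<open>A'\<close> and
    \<open>(B^2)' = 2 \<Phi> / A\<close> involve only the reciprocals of \<open>B^2\<close> and
    \<open>A\<close>. Differences of reciprocals are multiples of \<open>y\<close> and
    \<open>x\<close>, and \<open>h\<close> is the sum of the two coefficients.\<close>
  define y where "y t = (B1 t)\<^sup>2 - (B2 t)\<^sup>2" for t
  define h where "h t = \<Phi> / ((B1 t)\<^sup>2 * (B2 t)\<^sup>2) + 2 * \<Phi> / (A1 t * A2 t)" for t
  define D where "D t = (x t)\<^sup>2 + (y t)\<^sup>2" for t
  have D_deriv: "(D has_real_derivative - (h t * (2 * x t * y t))) (at t within {0..})"
    if t: "t \<ge> 0" for t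
  proof -
    note pos = S1.A_pos [OF t] S1.B_pos [OF t] S2.A_pos [OF t] S2.B_pos [OF t]
    have x: "(x has_real_derivative - (\<Phi> / ((B1 t)\<^sup>2 * (B2 t)\<^sup>2) * y t)) (at t within {0..})"
      unfolding x_def [abs_def]
      by (rule derivative_eq_intros S1.A_deriv S2.A_deriv t refl)+
        (use pos in \<open>simp add: y_def field_simps\<close>)
    have y: "(y has_real_derivative - (2 * \<Phi> / (A1 t * A2 t) * x t)) (at t within {0..})"
      unfolding y_def [abs_def]
      by (rule derivative_eq_intros S1.B_deriv S2.B_deriv t refl)+
        (use pos in \<open>simp add: x_def field_simps\<close>)
    show ?thesis
      unfolding D_def [abs_def]
      by (rule derivative_eq_intros x y refl)+ (simp add: h_def algebra_simps)
  qed
  \<comment> \<open>All denominators in \<open>h\<close> increase with time, so \<open>h 0\<close>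
    can serve as the Gronwall constant.\<close>
  have h: "0 \<le> h t" "h t \<le> h 0" if t: "t \<ge> 0" for t
  proof -
    note pos = S1.A_pos S2.A_pos S1.B_pos S2.B_pos S1.\<Phi>_pos
    show "0 \<le> h t"
      using pos t by (simp add: h_def less_imp_le)
    have "A1 0 * A2 0 \<le> A1 t * A2 t"
      by (intro mult_mono S1.A_mono S2.A_mono) (simp_all add: pos t less_imp_le)
    moreover have "(B1 0)\<^sup>2 * (B2 0)\<^sup>2 \<le> (B1 t)\<^sup>2 * (B2 t)\<^sup>2"
      by (intro mult_mono power_mono S1.B_mono S2.B_mono) (simp_all add: pos t less_imp_le)
    moreover have "A1 0 * A2 0 > 0" "(B1 0)\<^sup>2 * (B2 0)\<^sup>2 > 0"
      by (intro mult_pos_pos zero_less_power pos order_refl)+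
    ultimately show "h t \<le> h 0"
      unfolding h_def using S1.\<Phi>_pos by (intro add_mono frac_le) simp_all
  qed
  \<comment> \<open>Gronwall: \<open>D t * exp (- (h 0 * t))\<close> decreases from
    \<open>D 0 = 0\<close>. The minus sign fits the criterion for increasing functions.\<close>
  have "- (D 0 * exp (- (h 0 * 0))) \<le> - (D t * exp (- (h 0 * t)))"
  proof (rule increasing_if_deriv_within_nonneg [where b = 0
        and F = "\<lambda>t. - (D t * exp (- (h 0 * t)))"
        and F' = "\<lambda>t. (h 0 * D t + h t * (2 * x t * y t)) * exp (- (h 0 * t))"])
    fix t :: real assume t: "t \<ge> 0"
    show "((\<lambda>t. - (D t * exp (- (h 0 * t)))) has_real_derivative
        (h 0 * D t + h t * (2 * x t * y t)) * exp (- (h 0 * t))) (at t within {0..})"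
      by (rule derivative_eq_intros D_deriv t refl)+ (simp add: algebra_simps)
    \<comment> \<open>The cross term is absorbed by completing the square:
      \<open>D + 2 x y = (x + y)^2\<close>.\<close>
    have "0 \<le> h t * (x t + y t)\<^sup>2 + (h 0 - h t) * D t"
      using h [OF t] by (simp add: D_def)
    also have "\<dots> = h 0 * D t + h t * (2 * x t * y t)"
      by (simp add: D_def power2_sum algebra_simps)
    finally show "0 \<le> (h 0 * D t + h t * (2 * x t * y t)) * exp (- (h 0 * t))"
      by simp
  qed (use \<open>t \<ge> 0\<close> in auto)
  then have "D t \<le> 0"
    using init by (simp add: D_def x_def y_def mult_le_0_iff)
  then have "x t = 0"
    by (simp add: D_def sum_power2_le_zero_iff)
  then show ?thesis
    by (simp add: x_def)
qed

section \<open>Asymptotics of the flow\<close>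

text \<open>\<open>B' C\<close> and \<open>B C'\<close> equal \<open>C^2 / A\<close> with opposite
  signs, so \<open>B C\<close> keeps its initial value.\<close>

lemma reduced_nil_flow_of_harmonic_ricci_flow:
  assumes flow: "harmonic_ricci_flow c (\<lambda>t. nil_metric (A t) (B t) (C t)) (\<lambda>t p. a * p $ 1)"
    and c_nonneg: "\<And>t. t \<ge> 0 \<Longrightarrow> c t \<ge> 0"
  shows "reduced_nil_flow A B (\<lambda>t. 2 * a\<^sup>2 * c t) (B 0 * C 0)"
    and "t \<ge> 0 \<Longrightarrow> C t = B 0 * C 0 / B t"
proof -
  note pos = nil_flow_ode(1-3) [OF flow] and deriv = nil_flow_ode(4-6) [OF flow]
  have "((\<lambda>t. B t * C t) has_real_derivative 0) (at t within {0..})" if t: "t \<ge> 0" for t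
    by (rule derivative_eq_intros deriv t refl)+
      (use pos [OF t] in \<open>simp add: field_simps power2_eq_square\<close>)
  then have "\<exists>k. \<forall>t\<in>{0..}. B t * C t = k"
    by (intro has_field_derivative_zero_constant) auto
  then have BC: "B t * C t = B 0 * C 0" if "t \<ge> 0" for t
    using that by (metis atLeast_iff order_refl)
  show C: "C t = B 0 * C 0 / B t" if "t \<ge> 0" for t
    using BC [OF that] pos(2) [OF that] by (simp add: field_simps)
  show "reduced_nil_flow A B (\<lambda>t. 2 * a\<^sup>2 * c t) (B 0 * C 0)"
  proof
    fix t :: real assume t: "t \<ge> 0"
    show "(A has_real_derivative B 0 * C 0 / (B t)\<^sup>2 + 2 * a\<^sup>2 * c t) (at t within {0..})"
      using deriv(1) [OF t] C [OF t] by (simp add: power2_eq_square)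
    show "(B has_real_derivative B 0 * C 0 / (A t * B t)) (at t within {0..})"
      using deriv(2) [OF t] C [OF t] by (simp add: mult.commute)
    show "0 \<le> 2 * a\<^sup>2 * c t"
      using c_nonneg [OF t] by simp
  qed (use pos in simp_all)
qed

text \<open>The quotient tends to 1, hence is eventually below 2, and
  \<open>t powr r \<ge> t\<close> once \<open>t \<ge> 1\<close>.\<close>

lemma coupling_eventually_le:
  fixes c :: "real \<Rightarrow> real"
  assumes "r \<ge> 1" and "c \<sim>[at_top] (\<lambda>t. 1 / t powr r)"
  shows "\<forall>\<^sub>F t in at_top. c t \<le> 2 / t"
proof -
  \<comment> \<open>The case distinction is the convention 0/0 = 1 built into asymptotic
    equivalence.\<close>
  have "\<forall>\<^sub>F t in at_top. (if c t = 0 \<and> 1 / t powr r = 0 then 1 else c t / (1 / t powr r)) < 2"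
    by (rule order_tendstoD(2) [OF asymp_equivD [OF assms(2)]]) simp
  then show ?thesis
    using eventually_ge_at_top [of 1]
  proof eventually_elim
    case (elim t)
    then have "c t < 2 / t powr r"
      by (simp add: pos_less_divide_eq)
    also have "\<dots> \<le> 2 / t powr 1"
      using elim assms(1) by (intro divide_left_mono powr_mono mult_pos_pos) auto
    finally show ?case
      using elim by simp
  qed
qed

text \<open>Placing \<alpha> before the solutions expresses that it depends on the data alone; this
  is what calls for uniqueness.\<close>

theorem proposition5p15:
  fixes a r A0 B0 C0 \<Phi> :: real and c :: "real \<Rightarrow> real"
  assumes "r \<ge> 1"
    and "\<forall>t\<ge>0. c t \<ge> 0"
    and "antimono_on {0..} c"
    and "c \<sim>[at_top] (\<lambda>t. 1 / t powr r)"
    and "A0 > 0" and "B0 > 0" and "C0 > 0"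
    and "\<Phi> = B0 * C0"
  shows "\<exists>\<alpha>>0. \<forall>A B C :: real \<Rightarrow> real.
    A 0 = A0 \<and> B 0 = B0 \<and> C 0 = C0 \<and>
    harmonic_ricci_flow c (\<lambda>t. nil_metric (A t) (B t) (C t)) (\<lambda>t p. a * p $ 1) \<longrightarrow>
      A \<sim>[at_top] (\<lambda>t. \<alpha> * t powr (1/3)) \<and>
      B \<sim>[at_top] (\<lambda>t. sqrt (3 * \<Phi> / \<alpha>) * t powr (1/3)) \<and>
      C \<sim>[at_top] (\<lambda>t. sqrt (\<alpha> * \<Phi> / 3) * t powr (- 1/3))"
proof -
  define flow where "flow A B C \<longleftrightarrow> A 0 = A0 \<and> B 0 = B0 \<and> C 0 = C0 \<and>
    harmonic_ricci_flow c (\<lambda>t. nil_metric (A t) (B t) (C t)) (\<lambda>t p. a * p $ 1)" for A B C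
  define f where "f t = 2 * a\<^sup>2 * c t" for t
  have red: "reduced_nil_flow A B f \<Phi>" if "flow A B C" for A B C
    using that reduced_nil_flow_of_harmonic_ricci_flow(1) [of c A B C a] assms(2,8)
    by (simp add: flow_def f_def [abs_def])
  have C_eq: "C t = \<Phi> / B t" if "flow A B C" "t \<ge> 0" for A B C t
    using that reduced_nil_flow_of_harmonic_ricci_flow(2) [of c A B C a t] assms(2,8)
    by (simp add: flow_def)
  have "\<forall>\<^sub>F t in at_top. f t \<le> (4 * a\<^sup>2) / t"
    using coupling_eventually_le [OF assms(1,4)]
  proof eventually_elim
    case (elim t)
    from mult_left_mono [OF this, of "2 * a\<^sup>2"] show ?case
      by (simp add: f_def)
  qed
  note asym = reduced_nil_flow.asymptotics [OF red this]
  show ?thesis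
  proof (cases "\<exists>A B C. flow A B C")
    \<comment> \<open>Without a solution the claim is vacuous, and 1 is an arbitrary positive
      witness.\<close>
    case False
    then show ?thesis
      unfolding flow_def by (intro exI [of _ 1] conjI zero_less_one) blast
  next
    case True
    \<comment> \<open>\<alpha> is read off one reference solution; since any other solution has the
      same \<open>A\<close>, its constant \<beta> equals \<alpha>.\<close>
    then obtain A' B' C' where flow': "flow A' B' C'"
      by blast
    obtain \<alpha> where \<alpha>: "\<alpha> > 0" and A': "((\<lambda>t. A' t / t powr (1/3)) \<longlongrightarrow> \<alpha>) at_top"
      using asym [OF flow'] by blast
    have \<Phi>: "\<Phi> > 0"
      using assms by simp
    have "A \<sim>[at_top] (\<lambda>t. \<alpha> * t powr (1/3)) \<and>
      B \<sim>[at_top] (\<lambda>t. sqrt (3 * \<Phi> / \<alpha>) * t powr (1/3)) \<and>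
      C \<sim>[at_top] (\<lambda>t. sqrt (\<alpha> * \<Phi> / 3) * t powr (- 1/3))" if flow: "flow A B C" for A B C
    proof -
      obtain \<beta> where A: "((\<lambda>t. A t / t powr (1/3)) \<longlongrightarrow> \<beta>) at_top"
        and B: "((\<lambda>t. B t / t powr (1/3)) \<longlongrightarrow> sqrt (3 * \<Phi> / \<beta>)) at_top"
        using asym [OF flow] by blast
      have "A t = A' t" if "t \<ge> 0" for t
        using reduced_nil_flow_unique [OF red [OF flow] red [OF flow'] _ _ that] flow flow'
        by (simp add: flow_def)
      then have "\<forall>\<^sub>F t in at_top. A t / t powr (1/3) = A' t / t powr (1/3)"
        by (intro eventually_mono [OF eventually_ge_at_top [of 0]]) simp
      then have "((\<lambda>t. A' t / t powr (1/3)) \<longlongrightarrow> \<beta>) at_top"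
        by (rule Lim_transform_eventually [OF A])
      then have [simp]: "\<beta> = \<alpha>"
        using A' by (rule tendsto_unique [rotated]) simp
      \<comment> \<open>The behaviour of \<open>C\<close> follows from that of \<open>B\<close>
        through \<open>C = \<Phi> / B\<close>.\<close>
      have "((\<lambda>t. \<Phi> / (B t / t powr (1/3))) \<longlongrightarrow> \<Phi> / sqrt (3 * \<Phi> / \<alpha>)) at_top"
        using \<alpha> \<Phi> B by (intro tendsto_intros) auto
      moreover have "\<forall>\<^sub>F t in at_top. \<Phi> / (B t / t powr (1/3)) = C t / t powr (- 1/3)"
        using eventually_gt_at_top [of 0]
        by eventually_elim (simp add: C_eq [OF flow] powr_minus_divide)
      moreover have "\<Phi> / sqrt (3 * \<Phi> / \<alpha>) = sqrt (\<alpha> * \<Phi> / 3)"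
      proof -
        have "sqrt (\<alpha> * \<Phi> / 3) * sqrt (3 * \<Phi> / \<alpha>) = sqrt (\<Phi>\<^sup>2)"
          using \<alpha> by (simp add: real_sqrt_mult [symmetric] power2_eq_square)
        then show ?thesis
          using \<alpha> \<Phi> by (simp add: nonzero_divide_eq_eq)
      qed
      ultimately have C: "((\<lambda>t. C t / t powr (- 1/3)) \<longlongrightarrow> sqrt (\<alpha> * \<Phi> / 3)) at_top"
        using Lim_transform_eventually by metis
      \<comment> \<open>Passing from limits of quotients to equivalence needs nonzero constants,
        which the positivity of \<alpha> and \<Phi> provides.\<close>
      from asymp_equivI'_const [OF A] asymp_equivI'_const [OF B] asymp_equivI'_const [OF C]
      show ?thesis
        using \<alpha> \<Phi> by simp
    qed
    with \<alpha> show ?thesis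
      unfolding flow_def by blast
  qed
qed

end
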